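(* $R_{C_4}(3,4,3,4)=R(2,3,2,3)+1$; that is, $R_{C_4}(3,4,3,4)=7$.
   Context: $C_4\le S_4$ denotes the cyclic group generated by $(1\,2\,3\,4)$. A $4$-edge-coloured complete graph is a complete graph with each edge coloured from $\{1,2,3,4\}$. For $\pi\in C_4$ and a vertex $v$, switching at $v$ with $\pi$ recolours every edge incident with $v$ of colour $i$ to colour $\pi(i)$, leaving other edges unchanged. Two such graphs on the same vertex set are $C_4$-switch equivalent if one is obtained from the other by a finite sequence of switches. $K_t^{(i)}$ is a complete graph on $t$ vertices with all edges of colour $i$. $R_{C_4}(a_1,a_2,a_3,a_4)$ is the least $n$ such that every $4$-edge-coloured complete graph on $n$ vertices is $C_4$-switch equivalent to one containing, for some $i$, a copy of $K_{a_i}^{(i)}$. $R(2,3,2,3)$ is the classical $4$-colour Ramsey number (which equals $R(3,3)=6$). *)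

theory Defs
  imports "HOL-Algebra.Sym_Groups" "HOL-Library.Ramsey"
begin

text \<open>\<open>cycle_of_list [1, 2, 3, 4]\<close> is the permutation sending 1 to 2, 2 to 3, 3 to 4 and 4 to 1.\<close>

definition C4 :: "(nat \<Rightarrow> nat) set" where
  "C4 = generate (sym_group 4) {cycle_of_list [1, 2, 3, 4]}"

text \<open>
  A complete graph on \<open>V\<close> is given by its vertex set alone, so a coloured complete graph is
  a function on the 2-subsets of \<open>V\<close>. The functions are extensional (\<open>undefined\<close> off
  \<open>nsets V 2\<close>), so that equal functions are equal coloured graphs.
\<close>

definition edge_colourings :: "'a set \<Rightarrow> nat \<Rightarrow> ('a set \<Rightarrow> nat) set" where
  "edge_colourings V k = nsets V 2 \<rightarrow>\<^sub>E {1..k}"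

definition switch :: "'a set \<Rightarrow> 'a \<Rightarrow> (nat \<Rightarrow> nat) \<Rightarrow> ('a set \<Rightarrow> nat) \<Rightarrow> 'a set \<Rightarrow> nat" where
  "switch V v \<pi> c = (\<lambda>e\<in>nsets V 2. if v \<in> e then \<pi> (c e) else c e)"

definition switch_step ::
    "(nat \<Rightarrow> nat) set \<Rightarrow> 'a set \<Rightarrow> ('a set \<Rightarrow> nat) \<Rightarrow> ('a set \<Rightarrow> nat) \<Rightarrow> bool" where
  "switch_step G V c d \<longleftrightarrow> (\<exists>v\<in>V. \<exists>\<pi>\<in>G. d = switch V v \<pi> c)"

definition switch_equivalent ::
    "(nat \<Rightarrow> nat) set \<Rightarrow> 'a set \<Rightarrow> ('a set \<Rightarrow> nat) \<Rightarrow> ('a set \<Rightarrow> nat) \<Rightarrow> bool" where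
  "switch_equivalent G V = (switch_step G V)\<^sup>*\<^sup>*"

text \<open>The \<open>i\<close>-th colour is \<open>i\<close>, counted from 1, so its clique size is the list entry at \<open>i - 1\<close>.\<close>

definition switch_ramsey_number :: "(nat \<Rightarrow> nat) set \<Rightarrow> nat list \<Rightarrow> nat" where
  "switch_ramsey_number G a = (LEAST n. \<forall>c \<in> edge_colourings {..<n} (length a).
     \<exists>d. switch_equivalent G {..<n} c d \<and>
         (\<exists>i\<in>{1..length a}. monochromatic {..<n} (a ! (i - 1)) 2 d i))"

text \<open>In \<^const>\<open>partn_lst\<close> the colours are numbered from 0.\<close>

definition ramsey_number :: "nat list \<Rightarrow> nat" where
  "ramsey_number a = (LEAST n. partn_lst {..<n} a 2)"

end

theory Submission
  imports Defs "HOL-Number_Theory.Cong"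
begin

text \<open>
  For the upper bound, pick a vertex \<open>v\<close> and switch the other vertices until all edges at \<open>v\<close> have
  one colour. A monochromatic clique of colour \<open>i\<close> among the other vertices is then extended by
  \<open>v\<close>, by switching at \<open>v\<close> so that its edges get colour \<open>i\<close>. Thus the switching
  number exceeds the classical one by at most 1, for any group acting transitively on the colours.

  For the lower bound, read the colours modulo 4: switching replaces \<open>c {u, w}\<close> by
  \<open>c {u, w} + x u + x w\<close>. Hence the parity of the sum over a triangle is invariant, as is
  \<open>c {p, q} + c {r, s} - c {p, r} - c {q, s}\<close> modulo 4. In the complete graph on 6 vertices, give the
  edges of a pentagon colour 2 and all other edges colour 4. Every triangle sum is even, which
  excludes triangles of colours 1 and 3, and on every 4-set one of the 4-cycle invariants is 2, which
  excludes monochromatic 4-cliques. The lower bound for the classical number follows from that for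
  the switching number.
\<close>

section \<open>Switching\<close>

text \<open>The switching analogue of \<open>partn_lst\<close>: the property minimised in
  \<open>switch_ramsey_number\<close>, named so that it can be proved or refuted at individual
  \<open>n\<close>.\<close>

definition switch_arrows :: "(nat \<Rightarrow> nat) set \<Rightarrow> nat list \<Rightarrow> nat \<Rightarrow> bool" where
  "switch_arrows G a n \<longleftrightarrow> (\<forall>c \<in> edge_colourings {..<n} (length a).
     \<exists>d. switch_equivalent G {..<n} c d \<and>
         (\<exists>i\<in>{1..length a}. monochromatic {..<n} (a ! (i - 1)) 2 d i))"

lemma switch_ramsey_number_eq: "switch_ramsey_number G a = (LEAST n. switch_arrows G a n)"
  by (simp add: switch_ramsey_number_def switch_arrows_def)

lemma switch_doubleton:
  assumes "u \<in> V" "w \<in> V" "u \<noteq> w"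
  shows "switch V v \<pi> c {u, w} = (if v = u \<or> v = w then \<pi> (c {u, w}) else c {u, w})"
  using assms by (simp add: switch_def)

lemma switch_in_edge_colourings:
  assumes "c \<in> edge_colourings V k" "\<pi> ` {1..k} \<subseteq> {1..k}"
  shows "switch V v \<pi> c \<in> edge_colourings V k"
  using assms unfolding switch_def edge_colourings_def by (auto simp: PiE_iff image_subset_iff)

lemma switch_equivalent_switch:
  assumes "switch_equivalent G V c d" "v \<in> V" "\<pi> \<in> G"
  shows "switch_equivalent G V c (switch V v \<pi> d)"
proof -
  have "switch_step G V d (switch V v \<pi> d)"
    using assms by (auto simp: switch_step_def)
  with assms(1) show ?thesis
    unfolding switch_equivalent_def
    using rtranclp.rtrancl_into_rtrancl[of "switch_step G V" c d "switch V v \<pi> d"] by blast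
qed

text \<open>Switches are made at the leaves in \<open>W\<close>: one at \<open>x\<close> changes no
  edge at \<open>v\<close> except \<open>{v, x}\<close>, so leaves already treated keep colour
  \<open>j\<close>.\<close>

lemma switch_equivalent_star:
  assumes closed: "\<And>\<pi>. \<pi> \<in> G \<Longrightarrow> \<pi> ` {1..k} \<subseteq> {1..k}"
    and trans: "\<And>i j. i \<in> {1..k} \<Longrightarrow> j \<in> {1..k} \<Longrightarrow> \<exists>\<pi>\<in>G. \<pi> i = j"
    and "c \<in> edge_colourings V k" "j \<in> {1..k}" "v \<in> V" "finite W" "W \<subseteq> V - {v}"
  shows "\<exists>d \<in> edge_colourings V k. switch_equivalent G V c d \<and> (\<forall>w\<in>W. d {v, w} = j)"
  using \<open>finite W\<close> \<open>W \<subseteq> V - {v}\<close>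
proof (induction W rule: finite_induct)
  case empty
  then show ?case
    using assms(3) by (auto simp: switch_equivalent_def)
next
  case (insert x W)
  then obtain d where d: "d \<in> edge_colourings V k" "switch_equivalent G V c d" "\<forall>w\<in>W. d {v, w} = j"
    by auto
  have "d {v, x} \<in> {1..k}"
    using d(1) insert.prems \<open>v \<in> V\<close> by (auto simp: edge_colourings_def PiE_iff)
  with trans \<open>j \<in> {1..k}\<close> obtain \<pi> where \<pi>: "\<pi> \<in> G" "\<pi> (d {v, x}) = j"
    by blast
  have v: "v \<noteq> x" "x \<in> V"
    using insert.prems by auto
  have "switch V x \<pi> d {v, w} = j" if "w \<in> insert x W" for w
  proof (cases "w = x")
    case True
    then show ?thesis
      using v \<pi>(2) \<open>v \<in> V\<close> by (simp add: switch_doubleton)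
  next
    case False
    then have "w \<in> V" "w \<noteq> v" "d {v, w} = j"
      using that insert.prems d(3) by auto
    then show ?thesis
      using False v(1) \<open>v \<in> V\<close> by (simp add: switch_doubleton)
  qed
  moreover have "switch_equivalent G V c (switch V x \<pi> d)"
    using d(2) \<pi>(1) insert.prems by (auto intro: switch_equivalent_switch)
  ultimately show ?case
    using switch_in_edge_colourings[OF d(1) closed[OF \<pi>(1)]] by blast
qed

lemma switch_arrows_Suc:
  assumes closed: "\<And>\<pi>. \<pi> \<in> G \<Longrightarrow> \<pi> ` {1..length a} \<subseteq> {1..length a}"
    and trans: "\<And>i j. i \<in> {1..length a} \<Longrightarrow> j \<in> {1..length a} \<Longrightarrow> \<exists>\<pi>\<in>G. \<pi> i = j"
    and "a \<noteq> []" and part: "partn_lst {..<n} a 2"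
  shows "switch_arrows G (map Suc a) (Suc n)"
  unfolding switch_arrows_def
proof
  fix c assume "c \<in> edge_colourings {..<Suc n} (length (map Suc a))"
  then have c: "c \<in> edge_colourings {..<Suc n} (length a)"
    by simp
  \<comment> \<open>The common colour of the star at \<open>n\<close> is arbitrary; colour 1 exists
    because \<open>a\<close> is nonempty.\<close>
  have one: "1 \<in> {1..length a}"
    using \<open>a \<noteq> []\<close> by (cases a) auto
  have "n \<in> {..<Suc n}" "finite {..<n}" "{..<n} \<subseteq> {..<Suc n} - {n}"
    by auto
  from switch_equivalent_star[OF closed trans c one this]
  obtain d where d: "d \<in> edge_colourings {..<Suc n} (length a)"
      "switch_equivalent G {..<Suc n} c d" "\<forall>w\<in>{..<n}. d {n, w} = 1"
    by blast
  have d_range: "d e \<in> {1..length a}" if "e \<in> [{..<n}]\<^bsup>2\<^esup>" for e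
    using d(1) that nsets_mono[of "{..<n}" "{..<Suc n}" 2]
    by (auto simp: edge_colourings_def PiE_iff)
  \<comment> \<open>Classical colours start at 0; the subtraction is exact because \<open>d\<close>
    is at least 1 on edges.\<close>
  have "(\<lambda>e. d e - 1) \<in> [{..<n}]\<^bsup>2\<^esup> \<rightarrow> {..<length a}"
    using d_range by fastforce
  with part obtain i H where i: "i < length a" and H: "H \<in> [{..<n}]\<^bsup>(a ! i)\<^esup>"
      and mono: "(\<lambda>e. d e - 1) ` [H]\<^bsup>2\<^esup> \<subseteq> {i}"
    unfolding partn_lst_def monochromatic_def by blast
  have H_sub: "H \<subseteq> {..<n}" "finite H" "card H = a ! i"
    using H by (auto simp: nsets_def)
  \<comment> \<open>Classical colour \<open>i\<close> is \<open>Suc i\<close> here. Switching at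
    \<open>n\<close> carries the star colour 1 to it and leaves the edges inside \<open>H\<close>
    alone.\<close>
  from i trans[OF one, of "Suc i"] obtain \<pi> where \<pi>: "\<pi> \<in> G" "\<pi> 1 = Suc i"
    by auto
  define d' where "d' = switch {..<Suc n} n \<pi> d"
  have old: "d' {u, w} = Suc i" if "u \<in> H" "w \<in> H" "u \<noteq> w" for u w
  proof -
    have "{u, w} \<in> [H]\<^bsup>2\<^esup>" "{u, w} \<in> [{..<n}]\<^bsup>2\<^esup>"
      using that H_sub by auto
    then have "d {u, w} = Suc i"
      using mono d_range[of "{u, w}"] by fastforce
    moreover have "u < n" "w < n"
      using that H_sub by auto
    ultimately show ?thesis
      using that by (auto simp: d'_def switch_doubleton)
  qed
  have new: "d' {n, w} = Suc i" if "w \<in> H" for w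
    using that H_sub d(3) \<pi>(2) by (auto simp: d'_def switch_doubleton subset_iff)
  then have new': "d' {w, n} = Suc i" if "w \<in> H" for w
    using new[OF that] by (simp only: insert_commute)
  have "d' ` [insert n H]\<^bsup>2\<^esup> \<subseteq> {Suc i}"
  proof clarify
    fix e assume "e \<in> [insert n H]\<^bsup>2\<^esup>"
    then obtain u w where "e = {u, w}" "u \<in> insert n H" "w \<in> insert n H" "u \<noteq> w"
      by (rule nsets2_E)
    then show "d' e = Suc i"
      using old new new' by auto
  qed
  moreover have "insert n H \<in> [{..<Suc n}]\<^bsup>(Suc (a ! i))\<^esup>"
    using H_sub by (auto simp: nsets_def card_insert_if)
  ultimately have "monochromatic {..<Suc n} (map Suc a ! (Suc i - 1)) 2 d' (Suc i)"
    using i unfolding monochromatic_def by auto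
  moreover have "switch_equivalent G {..<Suc n} c d'"
    unfolding d'_def using d(2) \<pi>(1) by (auto intro: switch_equivalent_switch)
  ultimately show "\<exists>d. switch_equivalent G {..<Suc n} c d \<and>
      (\<exists>i\<in>{1..length (map Suc a)}. monochromatic {..<Suc n} (map Suc a ! (i - 1)) 2 d i)"
    using i by (intro exI[of _ d'] conjI bexI[of _ "Suc i"]) auto
qed

section \<open>The cyclic group on four colours\<close>

lemma cycle_1234:
  "cycle_of_list [1, 2, 3, 4] 1 = (2::nat)" "cycle_of_list [1, 2, 3, 4] 2 = (3::nat)"
  "cycle_of_list [1, 2, 3, 4] 3 = (4::nat)" "cycle_of_list [1, 2, 3, 4] 4 = (1::nat)"
  by (simp_all add: transpose_def)

lemma cycle_1234_in_sym_group: "cycle_of_list [1, 2, 3, 4] \<in> carrier (sym_group 4)"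
proof -
  have "set [1, 2, 3, 4] = {1..4::nat}"
    by auto
  then show ?thesis
    using cycle_permutes[of "[1, 2, 3, 4::nat]"] by (simp add: sym_group_carrier)
qed

lemma one_to_four: "{1..4::nat} = {1, 2, 3, 4}"
  by auto

text \<open>The generator adds 1 modulo 4, with 4 representing the residue 0, so every group element
  is a shift. Closure of the colour range belongs to the induction, since composing shifts requires
  \<open>h i\<close> to be a colour.\<close>

lemma C4_shift:
  assumes "\<pi> \<in> C4"
  shows "\<exists>k. \<forall>i\<in>{1..4}. \<pi> i \<in> {1..4} \<and> [\<pi> i = i + k] (mod 4)"
proof -
  define s :: "nat \<Rightarrow> nat" where "s = cycle_of_list [1, 2, 3, 4]"
  note s_simps = cycle_1234[folded s_def]
  have s_carrier: "s \<in> carrier (sym_group 4)"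
    using cycle_1234_in_sym_group by (simp only: s_def)
  from assms have "\<pi> \<in> generate (sym_group 4) {s}"
    by (simp only: C4_def s_def)
  then show ?thesis
  proof (induction rule: generate.induct)
    case one
    show ?case
      by (rule exI[of _ 0]) (simp add: sym_group_one)
  next
    case (incl h)
    then show ?case
      using s_simps unfolding one_to_four by (intro exI[of _ 1]) (simp add: cong_def)
  next
    case (inv h)
    have "inj s"
      using s_carrier permutes_inj by (auto simp: sym_group_carrier)
    then have "inv' s 1 = 4" "inv' s 2 = 1" "inv' s 3 = 2" "inv' s 4 = 3"
      by (simp_all add: inv_f_eq s_simps[simplified])
    moreover have "inv\<^bsub>sym_group 4\<^esub> h = inv' s"
      using inv s_carrier by simp
    \<comment> \<open>Modulo 4, shifting by 3 undoes shifting by 1.\<close>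
    ultimately show ?case
      unfolding one_to_four by (intro exI[of _ 3]) (simp add: cong_def)
  next
    case (eng g h)
    then obtain k l where
      k: "\<forall>i\<in>{1..4}. g i \<in> {1..4} \<and> [g i = i + k] (mod 4)" and
      l: "\<forall>i\<in>{1..4}. h i \<in> {1..4} \<and> [h i = i + l] (mod 4)"
      by blast
    have "[g (h i) = i + (l + k)] (mod 4)" if "i \<in> {1..4}" for i
    proof -
      have "[g (h i) = h i + k] (mod 4)" "[h i + k = i + l + k] (mod 4)"
        using that k l by (auto intro: cong_add)
      then show ?thesis
        by (metis cong_trans add.assoc)
    qed
    with k l show ?case
      unfolding sym_group_mult o_apply by (intro exI[of _ "l + k"]) blast
  qed
qed

lemma C4_closed: "\<pi> \<in> C4 \<Longrightarrow> \<pi> ` {1..4} \<subseteq> {1..4}"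
  using C4_shift by blast

lemma C4_transitive:
  assumes "i \<in> {1..4}" "j \<in> {1..4}"
  shows "\<exists>\<pi>\<in>C4. \<pi> i = j"
proof -
  define s :: "nat \<Rightarrow> nat" where "s = cycle_of_list [1, 2, 3, 4]"
  note s_simps = cycle_1234[folded s_def]
  have mult: "g \<circ> h \<in> C4" if "g \<in> C4" "h \<in> C4" for g h
    using generate.eng[of g "sym_group 4" _ h] that by (simp only: C4_def sym_group_mult)
  have "s \<in> C4"
    unfolding C4_def s_def by (rule generate.incl) simp
  then have pow: "s \<in> C4" "s \<circ> s \<in> C4" "s \<circ> (s \<circ> s) \<in> C4" "s \<circ> (s \<circ> (s \<circ> s)) \<in> C4"
    by (simp_all add: mult)
  \<comment> \<open>The powers shift by 1, 2, 3 and 4, so every difference modulo 4 occurs; the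
    fourth power covers \<open>i = j\<close>.\<close>
  have "s i = j \<or> (s \<circ> s) i = j \<or> (s \<circ> (s \<circ> s)) i = j \<or> (s \<circ> (s \<circ> (s \<circ> s))) i = j"
    using assms s_simps unfolding one_to_four by auto
  with pow show ?thesis
    by blast
qed

text \<open>The potential \<open>x v\<close> accumulates the shifts made at \<open>v\<close>, and an
  edge receives those of both its ends. The colour range is carried along because
  \<open>C4_shift\<close> describes a permutation only on the colours 1 to 4.\<close>

lemma switch_equivalent_C4_shift:
  assumes "switch_equivalent C4 V c d" and c: "c \<in> edge_colourings V 4"
  shows "d \<in> edge_colourings V 4 \<and>
    (\<exists>x. \<forall>u\<in>V. \<forall>w\<in>V. u \<noteq> w \<longrightarrow> [d {u, w} = c {u, w} + x u + x w] (mod 4))"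
  using assms(1) unfolding switch_equivalent_def
proof (induction rule: rtranclp_induct)
  case base
  show ?case
    using c by (intro conjI exI[of _ "\<lambda>_. 0"]) auto
next
  case (step d d')
  from step.hyps(2) obtain v \<pi> where v: "v \<in> V" "\<pi> \<in> C4" and d': "d' = switch V v \<pi> d"
    by (auto simp: switch_step_def)
  from step.IH obtain x where d: "d \<in> edge_colourings V 4"
    and x: "\<And>u w. u \<in> V \<Longrightarrow> w \<in> V \<Longrightarrow> u \<noteq> w \<Longrightarrow> [d {u, w} = c {u, w} + x u + x w] (mod 4)"
    by blast
  from C4_shift[OF v(2)] obtain k where k: "\<And>i. i \<in> {1..4} \<Longrightarrow> [\<pi> i = i + k] (mod 4)"
    by blast
  define y where "y = x(v := x v + k)"
  have "[d' {u, w} = c {u, w} + y u + y w] (mod 4)" if uw: "u \<in> V" "w \<in> V" "u \<noteq> w" for u w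
  proof (cases "v = u \<or> v = w")
    case True
    have "d {u, w} \<in> {1..4}"
      using d uw by (auto simp: edge_colourings_def PiE_iff)
    then have "[d' {u, w} = d {u, w} + k] (mod 4)"
      using k True uw by (simp add: d' switch_doubleton)
    also have "[d {u, w} + k = c {u, w} + x u + x w + k] (mod 4)"
      using x[OF uw] by (intro cong_add) auto
    also have "c {u, w} + x u + x w + k = c {u, w} + y u + y w"
      using True uw by (auto simp: y_def)
    finally show ?thesis .
  next
    case False
    then show ?thesis
      using x[OF uw] uw by (auto simp: d' switch_doubleton y_def)
  qed
  moreover have "d' \<in> edge_colourings V 4"
    unfolding d' using d C4_closed[OF v(2)] by (rule switch_in_edge_colourings)
  ultimately show ?case
    by blast
qed

section \<open>The pentagon colouring\<close>

text \<open>Vertex 5 lies off the pentagon, so all its edges have colour 4. Restricting this one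
  function serves every \<open>n \<le> 6\<close>.\<close>

definition pentagon_colouring :: "nat set \<Rightarrow> nat" where
  "pentagon_colouring e = (if e \<in> {{0, 1}, {1, 2}, {2, 3}, {3, 4}, {0, 4}} then 2 else 4)"

lemma even_pentagon_colouring: "even (pentagon_colouring e)"
  by (simp add: pentagon_colouring_def)

lemma pentagon_colouring_less:
  assumes "u < w"
  shows "pentagon_colouring {u, w} =
    (if (u, w) \<in> {(0, 1), (1, 2), (2, 3), (3, 4), (0, 4)} then 2 else 4)"
  using assms by (auto simp: pentagon_colouring_def doubleton_eq_iff)

text \<open>Modulo 4, a perfect matching sums to twice its number of pentagon edges, so these
  numbers would have the same parity for all three matchings. Four pentagon vertices induce a 3-edge
  path, giving 2, 0 and 1. With vertex 5, each matching leaves one pair of a pentagon triple, and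
  such a triple spans one or two pentagon edges, never none or three.\<close>

lemma pentagon_colouring_4_cycles:
  assumes "p < q" "q < r" "r < s" "s < 6"
  shows "\<not> ([pentagon_colouring {p, q} + pentagon_colouring {r, s} =
              pentagon_colouring {p, r} + pentagon_colouring {q, s}] (mod 4) \<and>
            [pentagon_colouring {p, q} + pentagon_colouring {r, s} =
              pentagon_colouring {p, s} + pentagon_colouring {q, r}] (mod 4))"
proof -
  \<comment> \<open>The ordering reduces the claim to a check of the fifteen 4-subsets of the
    vertices.\<close>
  have "p = 0 \<or> p = 1 \<or> p = 2" "q = 1 \<or> q = 2 \<or> q = 3"
    "r = 2 \<or> r = 3 \<or> r = 4" "s = 3 \<or> s = 4 \<or> s = 5"
    using assms by linarith+
  then show ?thesis
    using assms by (elim disjE) (simp_all add: pentagon_colouring_less cong_def)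
qed

lemma not_switch_arrows:
  assumes "n \<le> 6"
  shows "\<not> switch_arrows C4 [3, 4, 3, 4] n"
proof
  assume arrows: "switch_arrows C4 [3, 4, 3, 4] n"
  let ?c = "restrict pentagon_colouring ([{..<n}]\<^bsup>2\<^esup>)"
  have c: "?c \<in> edge_colourings {..<n} 4"
    by (auto simp: edge_colourings_def pentagon_colouring_def)
  have "length [3, 4, 3, 4 :: nat] = 4"
    by simp
  with arrows c obtain d i where d: "switch_equivalent C4 {..<n} ?c d" and i: "i \<in> {1..4}"
      and mono: "monochromatic {..<n} ([3, 4, 3, 4] ! (i - 1)) 2 d i"
    unfolding switch_arrows_def by metis
  obtain x where x: "\<And>u w. u < n \<Longrightarrow> w < n \<Longrightarrow> u \<noteq> w \<Longrightarrow>
      [d {u, w} = pentagon_colouring {u, w} + x u + x w] (mod 4)"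
    using switch_equivalent_C4_shift[OF d c] by (auto simp: cong_def)
  from mono obtain H where H: "H \<in> [{..<n}]\<^bsup>([3, 4, 3, 4] ! (i - 1))\<^esup>" and "d ` [H]\<^bsup>2\<^esup> \<subseteq> {i}"
    unfolding monochromatic_def by blast
  then have di: "d {u, w} = i" if "u \<in> H" "w \<in> H" "u \<noteq> w" for u w
    using that by (auto simp: image_subset_iff)
  have "H \<subseteq> {..<n}"
    using H by (simp add: nsets_def)
  then have xi: "[i = pentagon_colouring {u, w} + x u + x w] (mod 4)" if "u \<in> H" "w \<in> H" "u \<noteq> w" for u w
    using x[of u w] di[OF that] that by auto
  have parity: "even i \<longleftrightarrow> even (x u + x w)" if "u \<in> H" "w \<in> H" "u \<noteq> w" for u w
  proof -
    have "[i = pentagon_colouring {u, w} + x u + x w] (mod 2)"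
      using cong_dvd_modulus_nat[OF xi[OF that], of 2] by simp
    then have "even i \<longleftrightarrow> even (pentagon_colouring {u, w} + x u + x w)"
      by (simp add: cong_def even_iff_mod_2_eq_zero)
    then show ?thesis
      using even_pentagon_colouring by simp
  qed
  from i consider "i \<in> {1, 3}" | "i \<in> {2, 4}"
    by force
  then show False
  proof cases
    case 1
    then have "H \<in> [{..<n}]\<^bsup>3\<^esup>"
      using H by auto
    then obtain p q r where "H = {p, q, r}" "p \<noteq> q" "p \<noteq> r" "q \<noteq> r"
      by (auto simp: nsets_def card_3_iff)
    then have "even i \<longleftrightarrow> even (x p + x q)" "even i \<longleftrightarrow> even (x p + x r)"
      "even i \<longleftrightarrow> even (x q + x r)"
      using parity by auto
    \<comment> \<open>Each potential occurs in two of the three sums, so their total is even and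
      they cannot all be odd.\<close>
    moreover have "odd i"
      using 1 by auto
    ultimately show False
      by auto
  next
    case 2
    then have "H \<in> [{..<n}]\<^bsup>4\<^esup>"
      using H by auto
    then obtain p q r s where H_eq: "H = {p, q, r, s}" and less: "p < q" "q < r" "r < s" "s < n"
      unfolding ordered_nsets_4_eq by auto
    \<comment> \<open>Each perfect matching of the 4-set meets every vertex once, so all three sums
      contain the same total potential, which then cancels.\<close>
    have "[i + i = (pentagon_colouring {p, q} + x p + x q) + (pentagon_colouring {r, s} + x r + x s)] (mod 4)"
      "[i + i = (pentagon_colouring {p, r} + x p + x r) + (pentagon_colouring {q, s} + x q + x s)] (mod 4)"
      "[i + i = (pentagon_colouring {p, s} + x p + x s) + (pentagon_colouring {q, r} + x q + x r)] (mod 4)"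
      using less by (intro cong_add xi; simp add: H_eq)+
    then have eqs: "[i + i = pentagon_colouring {p, q} + pentagon_colouring {r, s} + (x p + x q + x r + x s)] (mod 4)"
      "[i + i = pentagon_colouring {p, r} + pentagon_colouring {q, s} + (x p + x q + x r + x s)] (mod 4)"
      "[i + i = pentagon_colouring {p, s} + pentagon_colouring {q, r} + (x p + x q + x r + x s)] (mod 4)"
      by (simp_all add: ac_simps)
    have "[pentagon_colouring {p, q} + pentagon_colouring {r, s} =
        pentagon_colouring {p, r} + pentagon_colouring {q, s}] (mod 4)"
      using cong_trans[OF cong_sym[OF eqs(1)] eqs(2)] by (simp only: cong_add_rcancel_nat)
    moreover have "[pentagon_colouring {p, q} + pentagon_colouring {r, s} =
        pentagon_colouring {p, s} + pentagon_colouring {q, r}] (mod 4)"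
      using cong_trans[OF cong_sym[OF eqs(1)] eqs(3)] by (simp only: cong_add_rcancel_nat)
    ultimately show False
      using pentagon_colouring_4_cycles[of p q r s] less assms by simp
  qed
qed

section \<open>The classical Ramsey number\<close>

lemma monochromatic_edge:
  assumes "e \<in> [V]\<^bsup>2\<^esup>"
  shows "monochromatic V 2 2 f (f e)"
proof -
  have "[e]\<^bsup>2\<^esup> = {e}"
    using assms by (auto elim!: nsets2_E)
  then show ?thesis
    using assms by (auto simp: monochromatic_def)
qed

lemma monochromatic_whole:
  assumes "\<forall>e\<in>[{..<m}]\<^bsup>2\<^esup>. f e = i"
  shows "monochromatic {..<m} m 2 f i"
  using assms by (auto simp: monochromatic_def)

text \<open>Base case of the Ramsey recursion: one edge of colour 0 suffices, and otherwise the
  whole graph has colour 1.\<close>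

lemma partn_lst_2_left: "partn_lst {..<m} [2, m] 2"
  unfolding partn_lst_def
proof
  fix f assume f: "f \<in> [{..<m}]\<^bsup>2\<^esup> \<rightarrow> {..<length [2, m]}"
  show "\<exists>i<length [2, m]. monochromatic {..<m} ([2, m] ! i) 2 f i"
  proof (cases "\<exists>e\<in>[{..<m}]\<^bsup>2\<^esup>. f e = 0")
    case True
    then show ?thesis
      using monochromatic_edge[of _ "{..<m}" f] by (intro exI[of _ 0]) force
  next
    case False
    then have "\<forall>e\<in>[{..<m}]\<^bsup>2\<^esup>. f e = 1"
      using f by (force simp: Pi_iff)
    then show ?thesis
      using monochromatic_whole by (intro exI[of _ 1]) simp
  qed
qed

lemma partn_lst_2_right: "partn_lst {..<m} [m, 2] 2"
  unfolding partn_lst_def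
proof
  fix f assume f: "f \<in> [{..<m}]\<^bsup>2\<^esup> \<rightarrow> {..<length [m, 2]}"
  show "\<exists>i<length [m, 2]. monochromatic {..<m} ([m, 2] ! i) 2 f i"
  proof (cases "\<exists>e\<in>[{..<m}]\<^bsup>2\<^esup>. f e = 1")
    case True
    then show ?thesis
      using monochromatic_edge[of _ "{..<m}" f] by (intro exI[of _ 1]) force
  next
    case False
    then have "\<forall>e\<in>[{..<m}]\<^bsup>2\<^esup>. f e = 0"
      using f by (force simp: Pi_iff)
    then show ?thesis
      using monochromatic_whole by (intro exI[of _ 0]) simp
  qed
qed

lemma partn_lst_3_3: "partn_lst {..<6::nat} [3, 3] 2"
proof -
  have "partn_lst {..<3::nat} [2, 3] 2" "partn_lst {..<3::nat} [3, 2] 2"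
    by (rule partn_lst_2_left partn_lst_2_right)+
  \<comment> \<open>Pigeonhole for the five edges at a fixed vertex: three share a colour. The
    recursion then yields 5 + 1 vertices.\<close>
  moreover have "partn_lst {..<5::nat} [3, 3] 1"
    using ramsey1_explicit[of 3 3] by simp
  ultimately show ?thesis
    using ramsey_induction_step[of 3 3 3 1 3 5] by (simp add: numeral_2_eq_2)
qed

text \<open>An edge of colour 0 or 2 is already a clique of size 2. Otherwise only 1 and 3 occur,
  and halving turns them into the colours 0 and 1 of \<open>[k, l]\<close>.\<close>

lemma partn_lst_insert_2s:
  assumes "partn_lst V [k, l] 2"
  shows "partn_lst V [2, k, 2, l] 2"
  unfolding partn_lst_def
proof
  fix f assume f: "f \<in> [V]\<^bsup>2\<^esup> \<rightarrow> {..<length [2, k, 2, l]}"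
  show "\<exists>i<length [2, k, 2, l]. monochromatic V ([2, k, 2, l] ! i) 2 f i"
  proof (cases "\<exists>e\<in>[V]\<^bsup>2\<^esup>. f e \<in> {0, 2}")
    case True
    then obtain e where e: "e \<in> [V]\<^bsup>2\<^esup>" "f e = 0 \<or> f e = 2"
      by auto
    then show ?thesis
      using monochromatic_edge[OF e(1), of f] by (auto intro: exI[of _ "f e"])
  next
    case False
    have f13: "f e = 1 \<or> f e = 3" if "e \<in> [V]\<^bsup>2\<^esup>" for e
    proof -
      have "f e < 4" "f e \<noteq> 0" "f e \<noteq> 2"
        using f False that by (auto simp: Pi_iff)
      then show ?thesis
        by linarith
    qed
    then have "(\<lambda>e. f e div 2) \<in> [V]\<^bsup>2\<^esup> \<rightarrow> {..<2}"
      by fastforce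
    then have "(\<lambda>e. f e div 2) \<in> [V]\<^bsup>2\<^esup> \<rightarrow> {..<length [k, l]}"
      by (simp add: numeral_2_eq_2)
    then obtain i H where i: "i < length [k, l]" and H: "H \<in> [V]\<^bsup>([k, l] ! i)\<^esup>"
      and mono: "(\<lambda>e. f e div 2) ` [H]\<^bsup>2\<^esup> \<subseteq> {i}"
      by (rule partn_lstE[OF assms _ refl])
    have "f e = 2 * i + 1" if "e \<in> [H]\<^bsup>2\<^esup>" for e
    proof -
      have "[H]\<^bsup>2\<^esup> \<subseteq> [V]\<^bsup>2\<^esup>"
        using H by (intro nsets_mono) (simp add: nsets_def)
      then show ?thesis
        using that mono f13[of e] by fastforce
    qed
    moreover have "[2, k, 2, l] ! (2 * i + 1) = [k, l] ! i"
      using i by (auto simp: less_Suc_eq)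
    ultimately have "monochromatic V ([2, k, 2, l] ! (2 * i + 1)) 2 f (2 * i + 1)"
      using H by (auto simp: monochromatic_def)
    then show ?thesis
      using i by (intro exI[of _ "2 * i + 1"]) auto
  qed
qed

text \<open>Used in both directions: it gives the switching upper bound from the classical one, and
  the classical lower bound from the switching one.\<close>

lemma partn_lst_imp_switch_arrows:
  assumes "partn_lst {..<n} [2, 3, 2, 3] 2"
  shows "switch_arrows C4 [3, 4, 3, 4] (Suc n)"
proof -
  have "length [2, 3, 2, 3 :: nat] = 4"
    by simp
  from switch_arrows_Suc[of C4 "[2, 3, 2, 3]" n, unfolded this, OF C4_closed C4_transitive _ assms]
  show ?thesis
    by simp
qed

theorem theorem24:
  shows "switch_ramsey_number C4 [3, 4, 3, 4] = ramsey_number [2, 3, 2, 3] + 1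
       \<and> switch_ramsey_number C4 [3, 4, 3, 4] = 7"
proof -
  have part: "partn_lst {..<6::nat} [2, 3, 2, 3] 2"
    by (intro partn_lst_insert_2s partn_lst_3_3)
  have "switch_ramsey_number C4 [3, 4, 3, 4] = 7"
    unfolding switch_ramsey_number_eq
  proof (rule Least_equality)
    show "switch_arrows C4 [3, 4, 3, 4] 7"
      using partn_lst_imp_switch_arrows[OF part] by simp
    show "7 \<le> n" if "switch_arrows C4 [3, 4, 3, 4] n" for n
      using that not_switch_arrows[of n] by linarith
  qed
  moreover have "ramsey_number [2, 3, 2, 3] = 6"
    unfolding ramsey_number_def
  proof (rule Least_equality)
    \<comment> \<open>A classical arrow at \<open>n\<close> gives a switching arrow at
      \<open>Suc n\<close>, which forces \<open>Suc n\<close> to be at least 7.\<close>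
    show "6 \<le> n" if "partn_lst {..<n} [2, 3, 2, 3] 2" for n :: nat
      using partn_lst_imp_switch_arrows[OF that] not_switch_arrows[of "Suc n"] by linarith
  qed (rule part)
  ultimately show ?thesis
    by simp
qed

end
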